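(* Let $\mathcal H$ be a real Hilbert space, let $f\in\Gamma_0(\mathcal H)$ and let $\lambda\in\left]0,+\infty\right[$. Then the following are equivalent: (i) $f$ is almost strictly convex. (ii) The Moreau envelope $e_\lambda f$ is strictly convex. (iii) The proximal mapping $\operatorname{Prox}_\lambda f$ is strictly nonexpansive, i.e., $\|\operatorname{Prox}_\lambda f(x)-\operatorname{Prox}_\lambda f(y)\|<\|x-y\|$ for all $x\neq y$ in $\mathcal H$.
   Context: $\Gamma_0(\mathcal H)$ is the set of proper, lower semicontinuous, convex functions $f:\mathcal H\to\left]-\infty,+\infty\right]$. The subdifferential is $\partial f(x)=\{v\in\mathcal H : f(y)\ge f(x)+\langle v,y-x\rangle\ \forall y\in\mathcal H\}$ and $\operatorname{dom}\partial f=\{x:\partial f(x)\neq\varnothing\}$. $f\in\Gamma_0(\mathcal H)$ is almost strictly convex if it is strictly convex along every line segment contained in $\operatorname{dom}\partial f$. The Moreau envelope is $e_\lambda f(x)=\inf_{w\in\mathcal H}\{f(w)+\frac1{2\lambda}\|x-w\|^2\}$ and the proximal mapping $\operatorname{Prox}_\lambda f(x)$ is the (unique) minimizer of $w\mapsto f(w)+\frac1{2\lambda}\|x-w\|^2$. *)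

theory Defs
  imports "HOL-Analysis.Analysis"
begin

text \<open>
  Extended-real-valued functions on a real Hilbert space are rendered with \<^typ>\<open>ereal\<close>, the Hilbert
  space being a type of class \<^class>\<open>real_inner\<close> and \<^class>\<open>complete_space\<close>.
\<close>

definition eff_dom :: "('a \<Rightarrow> ereal) \<Rightarrow> 'a set" where
  "eff_dom f = {x. f x < \<infinity>}"

definition proper :: "('a \<Rightarrow> ereal) \<Rightarrow> bool" where
  "proper f \<longleftrightarrow> (\<forall>x. f x \<noteq> -\<infinity>) \<and> eff_dom f \<noteq> {}"

definition lower_semicontinuous :: "('a::topological_space \<Rightarrow> ereal) \<Rightarrow> bool" where
  "lower_semicontinuous f \<longleftrightarrow> (\<forall>x. f x \<le> Liminf (nhds x) f)"

text \<open>
  In the two convexity notions the end points are taken in the domain of the function, so that for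
  functions avoiding \<open>-\<infinity>\<close> the right-hand sides are finite. In particular, strict inequality is
  never demanded between infinite values.
\<close>

definition convex_ereal :: "('a::real_vector \<Rightarrow> ereal) \<Rightarrow> bool" where
  "convex_ereal f \<longleftrightarrow>
    (\<forall>x\<in>eff_dom f. \<forall>y\<in>eff_dom f. \<forall>t::real. 0 < t \<and> t < 1 \<longrightarrow>
      f ((1 - t) *\<^sub>R x + t *\<^sub>R y) \<le> ereal (1 - t) * f x + ereal t * f y)"

definition strictly_convex_on :: "'a::real_vector set \<Rightarrow> ('a \<Rightarrow> ereal) \<Rightarrow> bool" where
  "strictly_convex_on S f \<longleftrightarrow>
    (\<forall>x\<in>S \<inter> eff_dom f. \<forall>y\<in>S \<inter> eff_dom f. \<forall>t::real. x \<noteq> y \<and> 0 < t \<and> t < 1 \<longrightarrow>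
      f ((1 - t) *\<^sub>R x + t *\<^sub>R y) < ereal (1 - t) * f x + ereal t * f y)"

definition Gamma0 :: "('a::real_inner \<Rightarrow> ereal) set" where
  "Gamma0 = {f. proper f \<and> lower_semicontinuous f \<and> convex_ereal f}"

definition subdifferential :: "('a::real_inner \<Rightarrow> ereal) \<Rightarrow> 'a \<Rightarrow> 'a set" where
  "subdifferential f x = {v. \<forall>y. f y \<ge> f x + ereal (v \<bullet> (y - x))}"

definition dom_subdifferential :: "('a::real_inner \<Rightarrow> ereal) \<Rightarrow> 'a set" where
  "dom_subdifferential f = {x. subdifferential f x \<noteq> {}}"

definition almost_strictly_convex :: "('a::real_inner \<Rightarrow> ereal) \<Rightarrow> bool" where
  "almost_strictly_convex f \<longleftrightarrow>
    (\<forall>a b. closed_segment a b \<subseteq> dom_subdifferential f \<longrightarrow>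
      strictly_convex_on (closed_segment a b) f)"

definition prox_objective :: "real \<Rightarrow> ('a::real_inner \<Rightarrow> ereal) \<Rightarrow> 'a \<Rightarrow> 'a \<Rightarrow> ereal" where
  "prox_objective l f x w = f w + ereal (1 / (2 * l) * (norm (x - w))\<^sup>2)"

definition moreau_envelope :: "real \<Rightarrow> ('a::real_inner \<Rightarrow> ereal) \<Rightarrow> 'a \<Rightarrow> ereal" where
  "moreau_envelope l f x = (INF w. prox_objective l f x w)"

text \<open>
  For \<open>f \<in> Gamma0\<close> and \<open>l > 0\<close> on a Hilbert space the minimizer exists and is unique, so the definite
  description is meaningful there.
\<close>

definition Prox :: "real \<Rightarrow> ('a::real_inner \<Rightarrow> ereal) \<Rightarrow> 'a \<Rightarrow> 'a" where
  "Prox l f x = (THE p. is_arg_min (prox_objective l f x) (\<lambda>_. True) p)"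

definition strictly_nonexpansive :: "('a::real_normed_vector \<Rightarrow> 'a) \<Rightarrow> bool" where
  "strictly_nonexpansive T \<longleftrightarrow> (\<forall>x y. x \<noteq> y \<longrightarrow> norm (T x - T y) < norm (x - y))"

end

theory Submission
  imports Defs
begin

text \<open>
  Write \<open>g x = (x - Prox x) / \<lambda>\<close>, which is the gradient of the envelope \<open>e\<close>. The minimizer \<open>p\<close> defining
  \<open>Prox x\<close> is characterized by \<open>(x - p) / \<lambda> \<in> \<partial>f p\<close>, and each of the three conditions turns out to be
  injectivity of \<open>g\<close>. For the envelope this follows from
  \<open>e y \<ge> e x + \<langle>g x, y - x\<rangle> + \<lambda>/2 \<parallel>g y - g x\<parallel>\<^sup>2\<close>; for the proximal mapping it follows from firm
  nonexpansiveness \<open>\<parallel>Prox x - Prox y\<parallel>\<^sup>2 + \<lambda>\<^sup>2 \<parallel>g x - g y\<parallel>\<^sup>2 \<le> \<parallel>x - y\<parallel>\<^sup>2\<close>; and for \<open>f\<close> the injectivity of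
  \<open>g\<close> says that distinct points have disjoint subdifferentials, which fails exactly when \<open>f\<close> is affine on
  a nontrivial segment of \<open>dom \<partial>f\<close>.
\<close>

section \<open>Subgradients of functions in \<open>Gamma0\<close>\<close>

lemma Gamma0_ereal_real:
  assumes "f \<in> Gamma0" "x \<in> eff_dom f"
  shows "f x = ereal (real_of_ereal (f x))"
  using assms by (cases "f x") (auto simp: Gamma0_def proper_def eff_dom_def)

lemma Gamma0_convexD:
  assumes f: "f \<in> Gamma0" and x: "x \<in> eff_dom f" and y: "y \<in> eff_dom f" and t: "0 < t" "t < 1"
  shows "(1 - t) *\<^sub>R x + t *\<^sub>R y \<in> eff_dom f"
    and "real_of_ereal (f ((1 - t) *\<^sub>R x + t *\<^sub>R y))
      \<le> (1 - t) * real_of_ereal (f x) + t * real_of_ereal (f y)"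
proof -
  let ?z = "(1 - t) *\<^sub>R x + t *\<^sub>R y"
  have "f ?z \<le> ereal (1 - t) * f x + ereal t * f y"
    using f x y t by (auto simp: Gamma0_def convex_ereal_def)
  also have "\<dots> = ereal ((1 - t) * real_of_ereal (f x) + t * real_of_ereal (f y))"
    by (subst (1 2) Gamma0_ereal_real[OF f]) (use x y in auto)
  finally have le: "f ?z \<le> ereal ((1 - t) * real_of_ereal (f x) + t * real_of_ereal (f y))" .
  then show z: "?z \<in> eff_dom f"
    by (auto simp: eff_dom_def)
  show "real_of_ereal (f ?z) \<le> (1 - t) * real_of_ereal (f x) + t * real_of_ereal (f y)"
    using le Gamma0_ereal_real[OF f z] by (metis ereal_less_eq(3))
qed

text \<open>Properness provides a point of finite value, and the subgradient inequality tested there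
  forces \<open>f p\<close> to be finite. Outside \<open>eff_dom f\<close> the inequality is
  trivial, so all later estimates can be carried out in the reals.\<close>

lemma in_subdifferential_iff:
  assumes f: "f \<in> Gamma0"
  shows "v \<in> subdifferential f p \<longleftrightarrow>
    p \<in> eff_dom f \<and> (\<forall>w\<in>eff_dom f. real_of_ereal (f p) + v \<bullet> (w - p) \<le> real_of_ereal (f w))"
proof (intro iffI conjI ballI; (elim conjE)?)
  assume v: "v \<in> subdifferential f p"
  obtain w0 where "f w0 < \<infinity>"
    using f by (auto simp: Gamma0_def proper_def eff_dom_def)
  moreover have "f p + ereal (v \<bullet> (w0 - p)) \<le> f w0"
    using v by (simp add: subdifferential_def)
  ultimately show p: "p \<in> eff_dom f"
    by (auto simp: eff_dom_def less_top[symmetric])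
  fix w assume w: "w \<in> eff_dom f"
  have "f p + ereal (v \<bullet> (w - p)) \<le> f w"
    using v by (simp add: subdifferential_def)
  then show "real_of_ereal (f p) + v \<bullet> (w - p) \<le> real_of_ereal (f w)"
    by (metis Gamma0_ereal_real[OF f] p w ereal_less_eq(3) plus_ereal.simps(1))
next
  assume p: "p \<in> eff_dom f"
    and le: "\<forall>w\<in>eff_dom f. real_of_ereal (f p) + v \<bullet> (w - p) \<le> real_of_ereal (f w)"
  have "f p + ereal (v \<bullet> (w - p)) \<le> f w" for w
  proof (cases "w \<in> eff_dom f")
    case True
    then show ?thesis
      using le by (metis Gamma0_ereal_real[OF f] p ereal_less_eq(3) plus_ereal.simps(1))
  qed (auto simp: eff_dom_def less_top[symmetric])
  then show "v \<in> subdifferential f p"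
    by (simp add: subdifferential_def)
qed

text \<open>Each subgradient inequality is tested at the base point of the other; in the sum the
  values of \<open>f\<close> cancel.\<close>

lemma subdifferential_monotone:
  assumes "f \<in> Gamma0" "u \<in> subdifferential f p" "v \<in> subdifferential f q"
  shows "0 \<le> (u - v) \<bullet> (p - q)"
proof -
  have "real_of_ereal (f p) + u \<bullet> (q - p) \<le> real_of_ereal (f q)"
       "real_of_ereal (f q) + v \<bullet> (p - q) \<le> real_of_ereal (f p)"
    using assms by (auto simp: in_subdifferential_iff)
  then show ?thesis by (simp add: inner_simps)
qed

lemma lsc_eventually_greater:
  assumes "lower_semicontinuous f" "c < f x"
  shows "eventually (\<lambda>w. c < f w) (nhds x)"
  using assms by (auto simp: lower_semicontinuous_def le_Liminf_iff)

text \<open>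
  This replaces the affine minorant that a separation theorem would give: convexity along rays
  propagates a lower bound near one point to the whole space.
\<close>

lemma Gamma0_minorant:
  assumes f: "f \<in> Gamma0"
  obtains x0 a b where "0 \<le> b"
    and "\<And>w. w \<in> eff_dom f \<Longrightarrow> a - b * norm (w - x0) \<le> real_of_ereal (f w)"
proof -
  obtain x0 where x0: "x0 \<in> eff_dom f"
    using f by (auto simp: Gamma0_def proper_def)
  let ?F = "\<lambda>w. real_of_ereal (f w)"
  have "ereal (?F x0 - 1) < f x0"
    by (subst Gamma0_ereal_real[OF f x0]) simp
  then have "eventually (\<lambda>w. ereal (?F x0 - 1) < f w) (nhds x0)"
    using f by (intro lsc_eventually_greater) (auto simp: Gamma0_def)
  then obtain r where r: "r > 0" and near: "\<And>w. dist w x0 < r \<Longrightarrow> ereal (?F x0 - 1) < f w"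
    by (auto simp: eventually_nhds_metric)
  have nearF: "?F x0 - 1 < ?F w" if "w \<in> eff_dom f" "dist w x0 < r" for w
    using near[OF that(2)] Gamma0_ereal_real[OF f that(1)] by (metis less_ereal.simps(1))
  have "?F x0 - 1 - 2 / r * norm (w - x0) \<le> ?F w" if w: "w \<in> eff_dom f" for w
  proof (cases "dist w x0 < r")
    case True
    have "0 \<le> 2 / r * norm (w - x0)" using r by simp
    then show ?thesis using nearF[OF w True] by linarith
  next
    case False
    define n where "n = norm (w - x0)"
    have n: "r \<le> n" "0 < n" using False r by (auto simp: dist_norm n_def)
    \<comment> \<open>This choice puts \<open>?z\<close> at distance \<open>r / 2\<close> from
      \<open>x0\<close>, inside the ball where the lower bound holds; convexity then carries that
      bound out to \<open>w\<close>.\<close>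
    define t where "t = r / (2 * n)"
    have t: "0 < t" "t < 1" using n r by (auto simp: t_def)
    let ?z = "(1 - t) *\<^sub>R x0 + t *\<^sub>R w"
    have "?z - x0 = t *\<^sub>R (w - x0)" by (simp add: algebra_simps)
    then have "dist ?z x0 = t * n" using t by (simp add: dist_norm n_def)
    also have "\<dots> < r" using n r by (simp add: t_def)
    finally have "?F x0 - 1 < ?F ?z"
      using nearF Gamma0_convexD(1)[OF f x0 w t] by blast
    also have "\<dots> \<le> (1 - t) * ?F x0 + t * ?F w"
      by (rule Gamma0_convexD(2)[OF f x0 w t])
    finally have "t * (?F x0 - ?F w) < 1" by (simp add: algebra_simps)
    then have "?F x0 - ?F w < 1 / t" using t by (simp add: field_simps)
    also have "1 / t = 2 / r * n" by (simp add: t_def)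
    finally show ?thesis by (simp add: n_def)
  qed
  then show thesis using r that[of "2 / r" "?F x0 - 1" x0] by simp
qed

section \<open>The proximal mapping\<close>

text \<open>The minorant of \<open>f\<close> decreases at most linearly, and the quadratic penalty
  dominates it.\<close>

lemma prox_objective_bounded_below:
  assumes f: "f \<in> Gamma0" and l: "0 < l"
  obtains m where
    "\<And>w. w \<in> eff_dom f \<Longrightarrow> m \<le> real_of_ereal (f w) + 1 / (2 * l) * (norm (x - w))\<^sup>2"
proof -
  obtain x0 a b where b: "0 \<le> b"
    and ab: "\<And>w. w \<in> eff_dom f \<Longrightarrow> a - b * norm (w - x0) \<le> real_of_ereal (f w)"
    using Gamma0_minorant[OF f] by metis
  have "a - b * norm (x - x0) - l * b\<^sup>2 / 2 \<le> real_of_ereal (f w) + 1 / (2 * l) * (norm (x - w))\<^sup>2"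
    if "w \<in> eff_dom f" for w
  proof -
    define s where "s = norm (x - w)"
    have "norm (w - x0) \<le> s + norm (x - x0)"
      unfolding s_def by (metis norm_minus_commute norm_triangle_ineq diff_add_cancel add_diff_eq)
    then have 1: "b * norm (w - x0) \<le> b * s + b * norm (x - x0)"
      using b by (metis distrib_left mult_left_mono)
    \<comment> \<open>Completing the square: \<open>s\<^sup>2 / (2 * l) - b * s\<close> is smallest
      at \<open>s = l * b\<close>, with value \<open>- l * b\<^sup>2 / 2\<close>.\<close>
    have "0 \<le> (s - l * b)\<^sup>2 / (2 * l)" using l by simp
    also have "\<dots> = 1 / (2 * l) * s\<^sup>2 - b * s + l * b\<^sup>2 / 2"
      using l by (simp add: field_simps power2_eq_square)
    finally show ?thesis using 1 ab[OF that] by (simp add: s_def)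
  qed
  then show thesis using that by blast
qed

text \<open>Midpoint convexity of \<open>f\<close> is added to the parallelogram law for
  \<open>x - u\<close> and \<open>x - v\<close>. For positive \<open>k\<close> the last term bounds
  the distance between two near-minimizers.\<close>

lemma prox_objective_midpoint:
  fixes x u v :: "'a::real_inner" and k :: real
  assumes f: "f \<in> Gamma0" and u: "u \<in> eff_dom f" and v: "v \<in> eff_dom f"
  defines "J \<equiv> \<lambda>w. real_of_ereal (f w) + k * (norm (x - w))\<^sup>2"
  shows "(1/2) *\<^sub>R u + (1/2) *\<^sub>R v \<in> eff_dom f"
    and "4 * J ((1/2) *\<^sub>R u + (1/2) *\<^sub>R v) \<le> 2 * J u + 2 * J v - k * (norm (u - v))\<^sup>2"
proof -
  let ?z = "(1/2) *\<^sub>R u + (1/2) *\<^sub>R v"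
  show "?z \<in> eff_dom f"
    using Gamma0_convexD(1)[OF f u v, of "1/2"] by simp
  have F: "2 * real_of_ereal (f ?z) \<le> real_of_ereal (f u) + real_of_ereal (f v)"
    using Gamma0_convexD(2)[OF f u v, of "1/2"] by simp
  have "4 * (norm (x - ?z))\<^sup>2 = 2 * (norm (x - u))\<^sup>2 + 2 * (norm (x - v))\<^sup>2 - (norm (u - v))\<^sup>2"
    by (simp add: power2_norm_eq_inner inner_simps inner_commute field_simps)
  then have "k * (4 * (norm (x - ?z))\<^sup>2)
      = k * (2 * (norm (x - u))\<^sup>2 + 2 * (norm (x - v))\<^sup>2 - (norm (u - v))\<^sup>2)"
    by (simp only:)
  then show "4 * J ?z \<le> 2 * J u + 2 * J v - k * (norm (u - v))\<^sup>2"
    using F by (simp add: J_def algebra_simps)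
qed

text \<open>A minimizing sequence is Cauchy by the midpoint estimate; completeness gives its limit,
  and lower semicontinuity shows that the infimum is attained there.\<close>

lemma prox_objective_minimizer_exists:
  fixes f :: "'a::{real_inner, complete_space} \<Rightarrow> ereal"
  assumes f: "f \<in> Gamma0" and l: "0 < l"
  obtains p where "p \<in> eff_dom f"
    and "\<And>w. w \<in> eff_dom f \<Longrightarrow> real_of_ereal (f p) + 1 / (2 * l) * (norm (x - p))\<^sup>2
           \<le> real_of_ereal (f w) + 1 / (2 * l) * (norm (x - w))\<^sup>2"
proof -
  define k where "k = 1 / (2 * l)"
  have k: "k > 0" using l by (simp add: k_def)
  define J where "J = (\<lambda>w. real_of_ereal (f w) + k * (norm (x - w))\<^sup>2)"
  \<comment> \<open>The infimum ranges over the domain only, because \<open>real_of_ereal\<close>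
    sends \<open>\<infinity>\<close> to 0 and \<open>J\<close> is meaningless elsewhere.\<close>
  define m where "m = (INF w\<in>eff_dom f. J w)"
  have bdd: "bdd_below (J ` eff_dom f)"
    using prox_objective_bounded_below[OF f l, of x] unfolding J_def k_def
    by (metis (mono_tags, lifting) bdd_belowI2)
  have ne: "eff_dom f \<noteq> {}" using f by (auto simp: Gamma0_def proper_def)
  have m: "m \<le> J w" if "w \<in> eff_dom f" for w
    unfolding m_def using bdd that by (rule cINF_lower)
  have "\<exists>w\<in>eff_dom f. J w < m + inverse (real (Suc n))" for n
    using cINF_less_iff[OF ne bdd, of "m + inverse (real (Suc n))"] by (simp add: m_def)
  then obtain w where w: "\<And>n. w n \<in> eff_dom f" "\<And>n. J (w n) < m + inverse (real (Suc n))"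
    by metis
  have close: "k * (norm (w i - w j))\<^sup>2 < 4 * inverse (real (Suc N))" if "N \<le> i" "N \<le> j" for i j N
  proof -
    have "4 * m \<le> 2 * J (w i) + 2 * J (w j) - k * (norm (w i - w j))\<^sup>2"
    proof -
      let ?z = "(1/2) *\<^sub>R w i + (1/2) *\<^sub>R w j"
      have "m \<le> J ?z"
        by (rule m) (rule prox_objective_midpoint(1)[OF f w(1) w(1)])
      moreover have "4 * J ?z \<le> 2 * J (w i) + 2 * J (w j) - k * (norm (w i - w j))\<^sup>2"
        unfolding J_def by (rule prox_objective_midpoint(2)[OF f w(1) w(1)])
      ultimately show ?thesis by linarith
    qed
    moreover have "J (w n) < m + inverse (real (Suc N))" if "N \<le> n" for n
    proof -
      have "inverse (real (Suc n)) \<le> inverse (real (Suc N))"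
        using that by (intro le_imp_inverse_le) auto
      then show ?thesis using w(2)[of n] by linarith
    qed
    ultimately show ?thesis
      using that by (smt (verit))
  qed
  have "Cauchy w"
  proof (rule metric_CauchyI)
    fix e :: real assume e: "e > 0"
    then have "k * e\<^sup>2 / 4 > 0" using k by simp
    then obtain N where N: "inverse (real (Suc N)) < k * e\<^sup>2 / 4"
      using reals_Archimedean by blast
    have "dist (w i) (w j) < e" if "N \<le> i" "N \<le> j" for i j
    proof -
      have "k * (norm (w i - w j))\<^sup>2 < k * e\<^sup>2"
        using close[OF that] N by linarith
      then have "(norm (w i - w j))\<^sup>2 < e\<^sup>2" using k by simp
      then show ?thesis using e by (simp add: dist_norm power2_less_imp_less)
    qed
    then show "\<exists>M. \<forall>i\<ge>M. \<forall>j\<ge>M. dist (w i) (w j) < e" by blast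
  qed
  then obtain p where p: "w \<longlonglongrightarrow> p"
    using convergent_eq_Cauchy by blast
  have q: "(\<lambda>n. k * (norm (x - w n))\<^sup>2) \<longlonglongrightarrow> k * (norm (x - p))\<^sup>2"
    by (intro tendsto_intros p)
  \<comment> \<open>Otherwise some real \<open>c\<close> lies strictly between the two sides. Lower
    semicontinuity keeps \<open>f (w n)\<close> above \<open>c\<close> eventually, and the limit of
    the bounds on \<open>J (w n)\<close> contradicts the choice of \<open>c\<close>. The finite
    bound also places \<open>p\<close> in the domain.\<close>
  have fp: "f p \<le> ereal (m - k * (norm (x - p))\<^sup>2)"
  proof (rule ccontr)
    assume "\<not> ?thesis"
    then obtain c where c: "m - k * (norm (x - p))\<^sup>2 < c" "ereal c < f p"
      using ereal_dense2 by (metis less_ereal.simps(1) not_le)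
    have "eventually (\<lambda>v. ereal c < f v) (nhds p)"
      using f c by (intro lsc_eventually_greater) (auto simp: Gamma0_def)
    then have "eventually (\<lambda>n. ereal c < f (w n)) sequentially"
      using p by (auto simp: filterlim_iff)
    then have "eventually (\<lambda>n. c + k * (norm (x - w n))\<^sup>2 \<le> m + inverse (real (Suc n))) sequentially"
    proof eventually_elim
      case (elim n)
      then have "c < real_of_ereal (f (w n))"
        using Gamma0_ereal_real[OF f w(1)[of n]] by (metis less_ereal.simps(1))
      then show ?case using w(2)[of n] by (simp add: J_def)
    qed
    moreover have "(\<lambda>n. c + k * (norm (x - w n))\<^sup>2) \<longlonglongrightarrow> c + k * (norm (x - p))\<^sup>2"
      by (intro tendsto_intros q)
    moreover have "(\<lambda>n. m + inverse (real (Suc n))) \<longlonglongrightarrow> m + 0"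
      by (intro tendsto_intros LIMSEQ_inverse_real_of_nat)
    ultimately have "c + k * (norm (x - p))\<^sup>2 \<le> m + 0"
      by (intro tendsto_le[OF sequentially_bot]) auto
    then show False using c by simp
  qed
  then have pD: "p \<in> eff_dom f" by (auto simp: eff_dom_def)
  have "real_of_ereal (f p) \<le> m - k * (norm (x - p))\<^sup>2"
    using fp Gamma0_ereal_real[OF f pD] by (metis ereal_less_eq(3))
  then have "J p \<le> J v" if "v \<in> eff_dom f" for v
    using m[OF that] by (simp add: J_def)
  then show thesis using that pD by (simp add: J_def k_def)
qed

text \<open>First-order condition: \<open>p\<close> is compared with nearby points of the segment
  towards \<open>w\<close>, and the quadratic remainder vanishes as these points approach
  \<open>p\<close>.\<close>

lemma minimizer_imp_subgradient:
  assumes f: "f \<in> Gamma0" and l: "0 < l" and p: "p \<in> eff_dom f"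
    and min: "\<And>w. w \<in> eff_dom f \<Longrightarrow> real_of_ereal (f p) + 1 / (2 * l) * (norm (x - p))\<^sup>2
           \<le> real_of_ereal (f w) + 1 / (2 * l) * (norm (x - w))\<^sup>2"
  shows "(1 / l) *\<^sub>R (x - p) \<in> subdifferential f p"
  unfolding in_subdifferential_iff[OF f]
proof (intro conjI ballI p)
  fix w assume w: "w \<in> eff_dom f"
  let ?F = "\<lambda>w. real_of_ereal (f w)"
  \<comment> \<open>\<open>A\<close> is the slack of the desired subgradient inequality. By
    convexity the objective increases from \<open>p\<close> to \<open>?z\<close> by at most
    \<open>t * (A + t * B)\<close>.\<close>
  define A where "A = ?F w - ?F p - (1 / l) * ((x - p) \<bullet> (w - p))"
  define B where "B = 1 / (2 * l) * (norm (w - p))\<^sup>2"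
  have "0 \<le> A + t * B" if t: "0 < t" "t < 1" for t
  proof -
    let ?z = "(1 - t) *\<^sub>R p + t *\<^sub>R w"
    have "x - ?z = (x - p) - t *\<^sub>R (w - p)" by (simp add: algebra_simps)
    then have "(norm (x - ?z))\<^sup>2
        = (norm (x - p))\<^sup>2 - 2 * t * ((x - p) \<bullet> (w - p)) + t\<^sup>2 * (norm (w - p))\<^sup>2"
      by (simp only: power2_norm_eq_inner)
        (simp add: inner_diff_left inner_diff_right inner_commute power2_eq_square algebra_simps)
    then have "1 / (2 * l) * (norm (x - ?z))\<^sup>2
        = 1 / (2 * l) * (norm (x - p))\<^sup>2 - t * ((1 / l) * ((x - p) \<bullet> (w - p))) + t * (t * B)"
      using l by (simp add: B_def field_simps power2_eq_square)
    moreover have "?F p + 1 / (2 * l) * (norm (x - p))\<^sup>2 \<le> ?F ?z + 1 / (2 * l) * (norm (x - ?z))\<^sup>2"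
      by (rule min) (rule Gamma0_convexD(1)[OF f p w t])
    moreover have "?F ?z \<le> (1 - t) * ?F p + t * ?F w"
      by (rule Gamma0_convexD(2)[OF f p w t])
    ultimately have "0 \<le> t * (A + t * B)"
      by (simp add: A_def algebra_simps)
    then show ?thesis using t by (simp add: zero_le_mult_iff)
  qed
  then have "eventually (\<lambda>t. 0 \<le> A + t * B) (at_right 0)"
    by (intro eventually_at_rightI[of 0 1]) auto
  moreover have "((\<lambda>t. A + t * B) \<longlongrightarrow> A + 0 * B) (at_right 0)"
    by (intro tendsto_intros)
  ultimately have "0 \<le> A + 0 * B"
    by (intro tendsto_lowerbound[of "\<lambda>t. A + t * B" _ "at_right 0"]) auto
  then show "?F p + (1 / l) *\<^sub>R (x - p) \<bullet> (w - p) \<le> ?F w"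
    by (simp add: A_def)
qed

text \<open>Expanding the square around \<open>p\<close>, the linear term is
  \<open>v \<bullet> (w - p)\<close> because \<open>x - p\<close> is \<open>l\<close> times
  \<open>v\<close>; the subgradient inequality absorbs it. The remaining quadratic margin yields
  both minimality and uniqueness of \<open>p\<close>.\<close>

lemma subgradient_imp_objective_growth:
  assumes f: "f \<in> Gamma0" and l: "0 < l" and v: "v \<in> subdifferential f p" and x: "x = p + l *\<^sub>R v"
  shows "prox_objective l f x p + ereal (1 / (2 * l) * (norm (w - p))\<^sup>2) \<le> prox_objective l f x w"
proof (cases "w \<in> eff_dom f")
  case True
  have p: "p \<in> eff_dom f"
    and le: "real_of_ereal (f p) + v \<bullet> (w - p) \<le> real_of_ereal (f w)"
    using v True by (auto simp: in_subdifferential_iff[OF f])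
  have "x - w = l *\<^sub>R v - (w - p)" using x by simp
  then have "(norm (x - w))\<^sup>2 = (norm (x - p))\<^sup>2 - 2 * l * (v \<bullet> (w - p)) + (norm (w - p))\<^sup>2"
    using x by (simp only: power2_norm_eq_inner)
      (simp add: inner_diff_left inner_diff_right inner_commute algebra_simps)
  then have "1 / (2 * l) * (norm (x - w))\<^sup>2
      = 1 / (2 * l) * (norm (x - p))\<^sup>2 - v \<bullet> (w - p) + 1 / (2 * l) * (norm (w - p))\<^sup>2"
    using l by (simp add: field_simps)
  with le have "real_of_ereal (f p) + 1 / (2 * l) * (norm (x - p))\<^sup>2 + 1 / (2 * l) * (norm (w - p))\<^sup>2
      \<le> real_of_ereal (f w) + 1 / (2 * l) * (norm (x - w))\<^sup>2"
    by linarith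
  then show ?thesis
    unfolding prox_objective_def
    by (subst Gamma0_ereal_real[OF f p], subst Gamma0_ereal_real[OF f True]) simp
qed (auto simp: eff_dom_def prox_objective_def less_top[symmetric])

lemma Prox_eqI:
  assumes f: "f \<in> Gamma0" and l: "0 < l" and v: "v \<in> subdifferential f p" and x: "x = p + l *\<^sub>R v"
  shows "Prox l f x = p"
  unfolding Prox_def
proof (rule the_equality)
  note growth = subgradient_imp_objective_growth[OF f l v x]
  have ge: "prox_objective l f x p \<le> prox_objective l f x w" for w
    by (rule order_trans[OF _ growth]) (use l in \<open>simp add: ereal_le_add_self\<close>)
  then show "is_arg_min (prox_objective l f x) (\<lambda>_. True) p"
    by (auto simp: is_arg_min_def not_less)
  fix q assume q: "is_arg_min (prox_objective l f x) (\<lambda>_. True) q"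
  have p: "p \<in> eff_dom f" using v by (simp add: in_subdifferential_iff[OF f])
  have "prox_objective l f x q \<le> prox_objective l f x p"
    using q by (auto simp: is_arg_min_def not_less)
  with growth have "prox_objective l f x p + ereal (1 / (2 * l) * (norm (q - p))\<^sup>2)
      \<le> prox_objective l f x p"
    by (rule order_trans)
  \<comment> \<open>Finiteness of \<open>f p\<close> allows the common value to be cancelled in
    \<open>ereal\<close>.\<close>
  moreover obtain c where "f p = ereal c" using Gamma0_ereal_real[OF f p] by blast
  ultimately have "1 / (2 * l) * (norm (q - p))\<^sup>2 \<le> 0"
    by (simp add: prox_objective_def)
  then show "q = p" using l by (simp add: divide_le_0_iff)
qed

text \<open>For \<open>f\<close> in \<open>Gamma0\<close> and positive \<open>l\<close> this is the
  Yosida approximation of the subdifferential.\<close>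

definition moreau_gradient :: "real \<Rightarrow> ('a::real_inner \<Rightarrow> ereal) \<Rightarrow> 'a \<Rightarrow> 'a" where
  "moreau_gradient l f x = (1 / l) *\<^sub>R (x - Prox l f x)"

lemma Prox_eq_diff:
  "0 < l \<Longrightarrow> Prox l f x = x - l *\<^sub>R moreau_gradient l f x"
  by (simp add: moreau_gradient_def)

lemma moreau_gradient_subgradient:
  fixes f :: "'a::{real_inner, complete_space} \<Rightarrow> ereal"
  assumes f: "f \<in> Gamma0" and l: "0 < l"
  shows "moreau_gradient l f x \<in> subdifferential f (Prox l f x)"
proof -
  obtain p where p: "p \<in> eff_dom f"
    "\<And>w. w \<in> eff_dom f \<Longrightarrow> real_of_ereal (f p) + 1 / (2 * l) * (norm (x - p))\<^sup>2
           \<le> real_of_ereal (f w) + 1 / (2 * l) * (norm (x - w))\<^sup>2"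
    using prox_objective_minimizer_exists[OF f l] by blast
  have v: "(1 / l) *\<^sub>R (x - p) \<in> subdifferential f p"
    using f l p by (rule minimizer_imp_subgradient)
  have "Prox l f x = p"
    by (rule Prox_eqI[OF f l v]) (use l in simp)
  then show ?thesis using v by (simp add: moreau_gradient_def)
qed

text \<open>Minty's parametrization: a pair \<open>(p, v)\<close> in the graph of the
  subdifferential is recovered from the single point \<open>p + l *\<^sub>R v\<close>.\<close>

lemma moreau_gradient_eqI:
  assumes "f \<in> Gamma0" "0 < l" "v \<in> subdifferential f p"
  shows "moreau_gradient l f (p + l *\<^sub>R v) = v"
  using Prox_eqI[OF assms refl] assms(2) by (simp add: moreau_gradient_def)

text \<open>Expand the square of \<open>x - y = d + l *\<^sub>R g\<close>; the cross term is
  nonnegative by monotonicity of the subdifferential.\<close>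

lemma Prox_firmly_nonexpansive:
  fixes f :: "'a::{real_inner, complete_space} \<Rightarrow> ereal"
  assumes f: "f \<in> Gamma0" and l: "0 < l"
  shows "(norm (Prox l f x - Prox l f y))\<^sup>2
      + l\<^sup>2 * (norm (moreau_gradient l f x - moreau_gradient l f y))\<^sup>2 \<le> (norm (x - y))\<^sup>2"
proof -
  define d where "d = Prox l f x - Prox l f y"
  define g where "g = moreau_gradient l f x - moreau_gradient l f y"
  have "x - y = d + l *\<^sub>R g"
    using l by (simp add: d_def g_def Prox_eq_diff algebra_simps)
  then have "(norm (x - y))\<^sup>2 = (norm d)\<^sup>2 + l\<^sup>2 * (norm g)\<^sup>2 + 2 * l * (g \<bullet> d)"
    by (simp only: power2_norm_eq_inner)
      (simp add: inner_add_left inner_add_right inner_commute power2_eq_square algebra_simps)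
  moreover have "0 \<le> g \<bullet> d"
    unfolding d_def g_def
    by (rule subdifferential_monotone[OF f moreau_gradient_subgradient[OF f l]
          moreau_gradient_subgradient[OF f l]])
  ultimately show ?thesis using l by (simp add: d_def g_def)
qed

text \<open>Where the gradients agree, \<open>Prox l f\<close> translates both points by the same
  vector and preserves their distance. Where they differ, firm nonexpansiveness has a positive extra
  term.\<close>

lemma strictly_nonexpansive_iff_inj:
  fixes f :: "'a::{real_inner, complete_space} \<Rightarrow> ereal"
  assumes f: "f \<in> Gamma0" and l: "0 < l"
  shows "strictly_nonexpansive (Prox l f) \<longleftrightarrow> inj (moreau_gradient l f)"
proof
  assume sn: "strictly_nonexpansive (Prox l f)"
  show "inj (moreau_gradient l f)"
  proof (rule injI, rule ccontr)
    fix x y assume eq: "moreau_gradient l f x = moreau_gradient l f y" and "x \<noteq> y"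
    then have "norm (Prox l f x - Prox l f y) < norm (x - y)"
      using sn by (simp add: strictly_nonexpansive_def)
    then show False using eq l by (simp add: Prox_eq_diff)
  qed
next
  assume inj: "inj (moreau_gradient l f)"
  show "strictly_nonexpansive (Prox l f)"
    unfolding strictly_nonexpansive_def
  proof (intro allI impI)
    fix x y :: 'a assume "x \<noteq> y"
    then have "0 < l\<^sup>2 * (norm (moreau_gradient l f x - moreau_gradient l f y))\<^sup>2"
      using inj l by (simp add: inj_eq)
    then have "(norm (Prox l f x - Prox l f y))\<^sup>2 < (norm (x - y))\<^sup>2"
      using Prox_firmly_nonexpansive[OF f l, of x y] by linarith
    then show "norm (Prox l f x - Prox l f y) < norm (x - y)"
      by (simp add: power2_less_imp_less)
  qed
qed

section \<open>The Moreau envelope\<close>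

text \<open>The infimum is attained at \<open>Prox l f x\<close>, and \<open>x - Prox l f x\<close>
  is \<open>l\<close> times the gradient. In particular the envelope is finite everywhere.\<close>

lemma moreau_envelope_eq:
  fixes f :: "'a::{real_inner, complete_space} \<Rightarrow> ereal"
  assumes f: "f \<in> Gamma0" and l: "0 < l"
  shows "moreau_envelope l f x = ereal (real_of_ereal (f (Prox l f x))
    + l / 2 * (norm (moreau_gradient l f x))\<^sup>2)"
proof -
  note v = moreau_gradient_subgradient[OF f l, of x]
  have x: "x = Prox l f x + l *\<^sub>R moreau_gradient l f x" using l by (simp add: Prox_eq_diff)
  have "prox_objective l f x (Prox l f x) \<le> prox_objective l f x w" for w
    by (rule order_trans[OF _ subgradient_imp_objective_growth[OF f l v x]])
      (use l in \<open>simp add: ereal_le_add_self\<close>)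
  then have "moreau_envelope l f x = prox_objective l f x (Prox l f x)"
    unfolding moreau_envelope_def by (intro antisym INF_lower INF_greatest) auto
  also have "norm (x - Prox l f x) = l * norm (moreau_gradient l f x)"
    using l by (simp add: Prox_eq_diff)
  then have "1 / (2 * l) * (norm (x - Prox l f x))\<^sup>2 = l / 2 * (norm (moreau_gradient l f x))\<^sup>2"
    using l by (simp add: power2_eq_square)
  then have "prox_objective l f x (Prox l f x) = f (Prox l f x)
      + ereal (l / 2 * (norm (moreau_gradient l f x))\<^sup>2)"
    by (simp only: prox_objective_def)
  also have "\<dots> = ereal (real_of_ereal (f (Prox l f x)) + l / 2 * (norm (moreau_gradient l f x))\<^sup>2)"
    by (subst Gamma0_ereal_real[OF f]) (use v in \<open>auto simp: in_subdifferential_iff[OF f]\<close>)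
  finally show ?thesis .
qed

lemma moreau_envelope_gradient_ineq:
  fixes f :: "'a::{real_inner, complete_space} \<Rightarrow> ereal"
  assumes f: "f \<in> Gamma0" and l: "0 < l"
  defines "e \<equiv> \<lambda>x. real_of_ereal (moreau_envelope l f x)" and "g \<equiv> moreau_gradient l f"
  shows "e x + g x \<bullet> (y - x) + l / 2 * (norm (g y - g x))\<^sup>2 \<le> e y"
proof -
  have "real_of_ereal (f (Prox l f x)) + g x \<bullet> (Prox l f y - Prox l f x)
      \<le> real_of_ereal (f (Prox l f y))"
    using moreau_gradient_subgradient[OF f l]
    by (auto simp: in_subdifferential_iff[OF f] g_def)
  moreover have "g x \<bullet> (Prox l f y - Prox l f x) = g x \<bullet> (y - x) - l * (g x \<bullet> (g y - g x))"
    using l by (simp add: Prox_eq_diff g_def inner_simps algebra_simps)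
  \<comment> \<open>Replacing \<open>Prox\<close> by the identity minus \<open>l\<close> times
    \<open>g\<close> leaves \<open>- l * (g x \<bullet> (g y - g x))\<close>, which together with
    the two penalty terms forms exactly this square.\<close>
  moreover have "l / 2 * (norm (g y - g x))\<^sup>2
      = l / 2 * (norm (g y))\<^sup>2 - l / 2 * (norm (g x))\<^sup>2 - l * (g x \<bullet> (g y - g x))"
    by (simp only: power2_norm_eq_inner)
      (simp add: inner_diff_left inner_diff_right inner_commute field_simps)
  moreover have "e z = real_of_ereal (f (Prox l f z)) + l / 2 * (norm (g z))\<^sup>2" for z
    by (simp add: e_def moreau_envelope_eq[OF f l] g_def)
  ultimately show ?thesis
    by (smt (verit))
qed

text \<open>Equal gradients at two points give parallel supporting affine functions, which keep the
  midpoint value from dropping below the average. With \<open>g\<close> injective, the square in the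
  gradient inequality makes support strict away from the base point.\<close>

lemma strictly_convex_moreau_envelope_iff_inj:
  fixes f :: "'a::{real_inner, complete_space} \<Rightarrow> ereal"
  assumes f: "f \<in> Gamma0" and l: "0 < l"
  shows "strictly_convex_on UNIV (moreau_envelope l f) \<longleftrightarrow> inj (moreau_gradient l f)"
proof -
  define e where "e = (\<lambda>x. real_of_ereal (moreau_envelope l f x))"
  define g where "g = moreau_gradient l f"
  have ereal_e: "moreau_envelope l f x = ereal (e x)" for x
    by (simp add: e_def moreau_envelope_eq[OF f l])
  have sc: "strictly_convex_on UNIV (moreau_envelope l f) \<longleftrightarrow>
      (\<forall>x y. \<forall>t::real. x \<noteq> y \<and> 0 < t \<and> t < 1 \<longrightarrow>
        e ((1 - t) *\<^sub>R x + t *\<^sub>R y) < (1 - t) * e x + t * e y)"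
    by (simp add: strictly_convex_on_def ereal_e eff_dom_def)
  have ineq: "e x + g x \<bullet> (y - x) + l / 2 * (norm (g y - g x))\<^sup>2 \<le> e y" for x y
    unfolding e_def g_def by (rule moreau_envelope_gradient_ineq[OF f l])
  have ineq0: "e x + g x \<bullet> (y - x) \<le> e y" for x y
    using ineq[of x y] l by (smt (verit) zero_le_mult_iff zero_le_power2 half_gt_zero)
  show ?thesis
    unfolding sc g_def[symmetric]
  proof
    assume strict: "\<forall>x y. \<forall>t::real. x \<noteq> y \<and> 0 < t \<and> t < 1 \<longrightarrow>
        e ((1 - t) *\<^sub>R x + t *\<^sub>R y) < (1 - t) * e x + t * e y"
    show "inj g"
    proof (rule injI, rule ccontr)
      fix x y assume eq: "g x = g y" and "x \<noteq> y"
      define z where "z = (1/2) *\<^sub>R x + (1/2) *\<^sub>R y"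
      have "2 * e z < e x + e y"
        using strict[rule_format, of x y "1/2"] \<open>x \<noteq> y\<close> by (simp add: z_def)
      moreover have "e x + g x \<bullet> (z - x) \<le> e z" "e y + g x \<bullet> (z - y) \<le> e z"
        using ineq0[of x z] ineq0[of y z] eq by auto
      moreover have "g x \<bullet> (z - x) + g x \<bullet> (z - y) = 0"
        by (simp add: z_def inner_simps)
      ultimately show False by linarith
    qed
  next
    assume inj: "inj g"
    show "\<forall>x y. \<forall>t::real. x \<noteq> y \<and> 0 < t \<and> t < 1 \<longrightarrow>
        e ((1 - t) *\<^sub>R x + t *\<^sub>R y) < (1 - t) * e x + t * e y"
    proof (intro allI impI, elim conjE)
      fix x y :: 'a and t :: real assume xy: "x \<noteq> y" and t: "0 < t" "t < 1"
      define z where "z = (1 - t) *\<^sub>R x + t *\<^sub>R y"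
      have "x - z = t *\<^sub>R (x - y)" by (simp add: z_def algebra_simps)
      then have "x \<noteq> z" using xy t by auto
      then have "0 < l / 2 * (norm (g x - g z))\<^sup>2" using inj l by (simp add: inj_eq)
      then have "e z + g z \<bullet> (x - z) < e x" using ineq[of z x] by linarith
      then have "(1 - t) * (e z + g z \<bullet> (x - z)) < (1 - t) * e x" using t by simp
      moreover have "t * (e z + g z \<bullet> (y - z)) \<le> t * e y" using ineq0[of z y] t by simp
      \<comment> \<open>The supporting affine function at \<open>z\<close> is averaged with the
        weights that define \<open>z\<close>, so its linear part cancels.\<close>
      moreover have "(1 - t) * (e z + g z \<bullet> (x - z)) + t * (e z + g z \<bullet> (y - z)) = e z"
      proof -
        have "g z \<bullet> z = g z \<bullet> ((1 - t) *\<^sub>R x + t *\<^sub>R y)" by (simp only: z_def)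
        then have "g z \<bullet> z = (1 - t) * (g z \<bullet> x) + t * (g z \<bullet> y)" by (simp only: inner_simps)
        then show ?thesis by (simp add: inner_diff_right algebra_simps)
      qed
      ultimately show "e z < (1 - t) * e x + t * e y" by linarith
    qed
  qed
qed

section \<open>Almost strict convexity\<close>

text \<open>A common subgradient \<open>v\<close> of \<open>p\<close> and \<open>q\<close> is the
  gradient at both \<open>p + l *\<^sub>R v\<close> and \<open>q + l *\<^sub>R v\<close>.
  Conversely, equal gradients at \<open>x\<close> and \<open>y\<close> are a common subgradient at
  the two proximal points; once these coincide, so do \<open>x\<close> and \<open>y\<close>.\<close>

lemma inj_moreau_gradient_iff_disjoint_subdifferentials:
  fixes f :: "'a::{real_inner, complete_space} \<Rightarrow> ereal"
  assumes f: "f \<in> Gamma0" and l: "0 < l"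
  shows "inj (moreau_gradient l f) \<longleftrightarrow>
    (\<forall>p q. p \<noteq> q \<longrightarrow> subdifferential f p \<inter> subdifferential f q = {})"
proof
  assume inj: "inj (moreau_gradient l f)"
  have "p = q" if "v \<in> subdifferential f p" "v \<in> subdifferential f q" for p q v
  proof -
    have "moreau_gradient l f (p + l *\<^sub>R v) = moreau_gradient l f (q + l *\<^sub>R v)"
      using that by (simp add: moreau_gradient_eqI[OF f l])
    then show ?thesis using inj by (simp add: inj_eq)
  qed
  then show "\<forall>p q. p \<noteq> q \<longrightarrow> subdifferential f p \<inter> subdifferential f q = {}" by blast
next
  assume disj: "\<forall>p q. p \<noteq> q \<longrightarrow> subdifferential f p \<inter> subdifferential f q = {}"
  show "inj (moreau_gradient l f)"
  proof (rule injI)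
    fix x y assume eq: "moreau_gradient l f x = moreau_gradient l f y"
    have "moreau_gradient l f x \<in> subdifferential f (Prox l f x) \<inter> subdifferential f (Prox l f y)"
      using moreau_gradient_subgradient[OF f l, of x] moreau_gradient_subgradient[OF f l, of y] eq
      by auto
    then have "Prox l f x = Prox l f y" using disj by blast
    then show "x = y" using eq l by (simp add: Prox_eq_diff)
  qed
qed

text \<open>
  A common subgradient at both end points forces \<open>f\<close> to be affine along the segment, with the same
  subgradient throughout.
\<close>

lemma common_subgradient_segment:
  assumes f: "f \<in> Gamma0" and vp: "v \<in> subdifferential f p" and vq: "v \<in> subdifferential f q"
    and t: "0 < t" "t < 1"
  defines "z \<equiv> (1 - t) *\<^sub>R p + t *\<^sub>R q"
  shows "v \<in> subdifferential f z"
    and "real_of_ereal (f z) = (1 - t) * real_of_ereal (f p) + t * real_of_ereal (f q)"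
proof -
  let ?F = "\<lambda>w. real_of_ereal (f w)"
  have p: "p \<in> eff_dom f" and lep: "\<And>w. w \<in> eff_dom f \<Longrightarrow> ?F p + v \<bullet> (w - p) \<le> ?F w"
    and q: "q \<in> eff_dom f" and leq: "\<And>w. w \<in> eff_dom f \<Longrightarrow> ?F q + v \<bullet> (w - q) \<le> ?F w"
    using vp vq by (auto simp: in_subdifferential_iff[OF f])
  have z: "z \<in> eff_dom f" and le: "?F z \<le> (1 - t) * ?F p + t * ?F q"
    unfolding z_def by (rule Gamma0_convexD[OF f p q t])+
  have "v \<bullet> (q - p) = - (v \<bullet> (p - q))" by (simp add: inner_simps)
  \<comment> \<open>Testing the subgradient inequality at \<open>p\<close> in \<open>q\<close>, and
    the one at \<open>q\<close> in \<open>p\<close>, gives both bounds.\<close>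
  then have Fq: "?F q = ?F p + v \<bullet> (q - p)"
    using lep[OF q] leq[OF p] by linarith
  have vz: "v \<bullet> (z - p) = t * (v \<bullet> (q - p))"
    by (simp add: z_def inner_simps algebra_simps)
  have "(1 - t) * ?F p + t * ?F q = ?F p + v \<bullet> (z - p)"
    unfolding Fq vz by (simp add: algebra_simps)
  with le lep[OF z] show eq: "?F z = (1 - t) * ?F p + t * ?F q" by linarith
  with \<open>(1 - t) * ?F p + t * ?F q = ?F p + v \<bullet> (z - p)\<close> have "?F z = ?F p + v \<bullet> (z - p)" by simp
  then have "?F z + v \<bullet> (w - z) = ?F p + v \<bullet> (w - p)" for w by (simp add: inner_simps)
  then show "v \<in> subdifferential f z"
    using z lep by (simp add: in_subdifferential_iff[OF f])
qed

text \<open>A common subgradient at two points makes \<open>f\<close> affine on a segment inside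
  \<open>dom_subdifferential f\<close>. Conversely, a subgradient at an interior point
  \<open>z\<close> gives an affine minorant touching at \<open>z\<close>, and disjointness forbids
  it to touch at another point.\<close>

lemma almost_strictly_convex_iff_disjoint_subdifferentials:
  assumes f: "f \<in> Gamma0"
  shows "almost_strictly_convex f \<longleftrightarrow>
    (\<forall>p q. p \<noteq> q \<longrightarrow> subdifferential f p \<inter> subdifferential f q = {})"
proof
  assume asc: "almost_strictly_convex f"
  have "p = q" if v: "v \<in> subdifferential f p" "v \<in> subdifferential f q" for p q v
  proof (rule ccontr)
    assume "p \<noteq> q"
    have "closed_segment p q \<subseteq> dom_subdifferential f"
    proof
      fix z assume "z \<in> closed_segment p q"
      then obtain t where "0 \<le> t" "t \<le> 1" and z: "z = (1 - t) *\<^sub>R p + t *\<^sub>R q"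
        by (auto simp: in_segment)
      then consider "z = p" | "z = q" | "0 < t" "t < 1" by fastforce
      then have "v \<in> subdifferential f z"
        using v common_subgradient_segment(1)[OF f v] z by cases auto
      then show "z \<in> dom_subdifferential f" by (auto simp: dom_subdifferential_def)
    qed
    then have sc: "strictly_convex_on (closed_segment p q) f"
      using asc by (simp add: almost_strictly_convex_def)
    \<comment> \<open>The coefficient \<open>1 - 1/2\<close> is left unevaluated so that the segment
      lemmas apply verbatim with parameter \<open>1/2\<close>.\<close>
    let ?z = "(1 - 1/2) *\<^sub>R p + (1/2) *\<^sub>R q"
    have D: "p \<in> eff_dom f" "q \<in> eff_dom f"
      using v by (auto simp: in_subdifferential_iff[OF f])
    have h: "(0::real) < 1/2" "(1/2::real) < 1" by auto
    have "f ?z < ereal (1 - 1/2) * f p + ereal (1/2) * f q"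
      using sc[unfolded strictly_convex_on_def, rule_format, of p q "1/2"] D \<open>p \<noteq> q\<close> h by auto
    also have "\<dots> = ereal ((1 - 1/2) * real_of_ereal (f p) + (1/2) * real_of_ereal (f q))"
      by (subst Gamma0_ereal_real[OF f D(1)], subst Gamma0_ereal_real[OF f D(2)]) simp
    also have "\<dots> = ereal (real_of_ereal (f ?z))"
      unfolding common_subgradient_segment(2)[OF f v h] ..
    also have "\<dots> = f ?z"
      using Gamma0_ereal_real[OF f Gamma0_convexD(1)[OF f D h]] by simp
    finally show False by simp
  qed
  then show "\<forall>p q. p \<noteq> q \<longrightarrow> subdifferential f p \<inter> subdifferential f q = {}" by blast
next
  assume disj: "\<forall>p q. p \<noteq> q \<longrightarrow> subdifferential f p \<inter> subdifferential f q = {}"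
  let ?F = "\<lambda>w. real_of_ereal (f w)"
  show "almost_strictly_convex f"
    unfolding almost_strictly_convex_def strictly_convex_on_def
  proof (intro allI impI ballI, elim conjE)
    fix a b x y and t :: real
    assume sub: "closed_segment a b \<subseteq> dom_subdifferential f"
      and x: "x \<in> closed_segment a b \<inter> eff_dom f" and y: "y \<in> closed_segment a b \<inter> eff_dom f"
      and xy: "x \<noteq> y" and t: "0 < t" "t < 1"
    define z where "z = (1 - t) *\<^sub>R x + t *\<^sub>R y"
    have "z \<in> closed_segment x y"
      unfolding z_def in_segment using t by (intro exI[of _ t]) auto
    then have "z \<in> closed_segment a b"
      using x y by (meson IntD1 subset_closed_segment subsetD)
    then obtain v where v: "v \<in> subdifferential f z"
      using sub by (auto simp: dom_subdifferential_def)
    then have z: "z \<in> eff_dom f" and le: "\<And>w. w \<in> eff_dom f \<Longrightarrow> ?F z + v \<bullet> (w - z) \<le> ?F w"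
      by (auto simp: in_subdifferential_iff[OF f])
    have "x - z = t *\<^sub>R (x - y)" by (simp add: z_def algebra_simps)
    then have "x \<noteq> z" using xy t by auto
    \<comment> \<open>If the minorant touched \<open>f\<close> at \<open>x\<close>, the same affine
      function would make \<open>v\<close> a subgradient at \<open>x\<close> as well as at
      \<open>z\<close>.\<close>
    have "?F z + v \<bullet> (x - z) \<noteq> ?F x"
    proof
      assume eq: "?F z + v \<bullet> (x - z) = ?F x"
      then have "?F x + v \<bullet> (w - x) = ?F z + v \<bullet> (w - z)" for w
        by (simp add: inner_simps)
      then have "v \<in> subdifferential f x"
        using x le by (simp add: in_subdifferential_iff[OF f])
      then show False using v disj \<open>x \<noteq> z\<close> by blast
    qed
    then have "?F z + v \<bullet> (x - z) < ?F x" using le[of x] x by simp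
    then have "(1 - t) * (?F z + v \<bullet> (x - z)) < (1 - t) * ?F x" using t by simp
    moreover have "t * (?F z + v \<bullet> (y - z)) \<le> t * ?F y" using le[of y] y t by simp
    moreover have "(1 - t) * (?F z + v \<bullet> (x - z)) + t * (?F z + v \<bullet> (y - z)) = ?F z"
      by (simp add: z_def inner_simps algebra_simps)
    ultimately have "ereal (?F z) < ereal ((1 - t) * ?F x + t * ?F y)" by simp
    also have "ereal ((1 - t) * ?F x + t * ?F y) = ereal (1 - t) * f x + ereal t * f y"
      by (subst (3) Gamma0_ereal_real[OF f], use x in simp, subst (4) Gamma0_ereal_real[OF f])
        (use y in auto)
    finally show "f z < ereal (1 - t) * f x + ereal t * f y"
      using Gamma0_ereal_real[OF f z] by simp
  qed
qed

theorem theorem7p15: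
  fixes f :: "'a::{real_inner, complete_space} \<Rightarrow> ereal" and l :: real
  assumes "f \<in> Gamma0" and "0 < l"
  shows "(almost_strictly_convex f \<longleftrightarrow> strictly_convex_on UNIV (moreau_envelope l f)) \<and>
    (strictly_convex_on UNIV (moreau_envelope l f) \<longleftrightarrow> strictly_nonexpansive (Prox l f))"
  using almost_strictly_convex_iff_disjoint_subdifferentials[OF assms(1)]
    inj_moreau_gradient_iff_disjoint_subdifferentials[OF assms]
    strictly_convex_moreau_envelope_iff_inj[OF assms]
    strictly_nonexpansive_iff_inj[OF assms]
  by simp

end
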